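(* Let $k$ be a positive integer and let $\lambda$ be an integer partition of $k$ with no part equal to $1$, and let $\ell$ be the length (number of parts) of $\lambda$. If $\mathbf{S}$ is a $\lambda$-uniform graph-like scheduling problem with size $|\mathbf{S}| < 2^{k-\ell}$, then $\mathbf{S}$ has property B. Hence $2^{k-\ell} \leq ms(\lambda)$ for every integer partition $\lambda$ of $k$ of length $\ell$ with no part equal to $1$.
   Context: A graph-like scheduling problem on $n$ elements is a Boolean formula $\mathbf{S} = \bigwedge_{\alpha \in J} \mathbf{C}_\alpha$ ($J$ finite) where each clause is a disjunction $\mathbf{C} = \bigvee_{(i,j)\in I} (x_i \neq x_j)$ with $i,j \in [n]=\{1,\dots,n\}$ and $i \neq j$ for $(i,j)\in I$. Its size is $|\mathbf{S}| = |J|$. A solution is an assignment of a nonnegative integer to each $x_i$ making $\mathbf{S}$ true. $\mathbf{S}$ has property B if it has a solution in which each $x_i$, $i\in[n]$, is assigned $0$ or $1$. For a clause $\mathbf{C} = \bigvee_{(i,j)\in I} (x_i \neq x_j)$, $G_{\mathbf{C}}$ is the graph with vertex set $V_{\mathbf{C}} = \{i : (i,j)\in I \text{ or } (j,i)\in I \text{ for some } j\}$ and edge set $\{ij : (i,j)\in I\}$, and $\lambda(\mathbf{C})$ is the integer partition of $|V_{\mathbf{C}}|$ given by the sizes of the connected components of $G_{\mathbf{C}}$. Two clauses whose graphs have the same connected components (same vertex sets of components) are logically equivalent and are identified. Integer partitions are weakly decreasing finite sequences of positive integers. $\mathbf{S}$ is $\lambda$-uniform if $\lambda(\mathbf{C}_\alpha)=\lambda$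 for every $\alpha\in J$. For a partition $\lambda$ with no part equal to $1$, $ms(\lambda)$ is the minimum possible size of a $\lambda$-uniform graph-like scheduling problem (on any number $n$ of elements) that does not have property B. *)

theory Defs
  imports "HOL-Library.Multiset"
begin

definition integer_partition :: "nat \<Rightarrow> nat list \<Rightarrow> bool" where
  "integer_partition k lam \<longleftrightarrow>
     sorted_wrt (\<ge>) lam \<and> (\<forall>p\<in>set lam. 0 < p) \<and> sum_list lam = k"

text \<open>The index set \<open>I\<close> of pairs represents the clause that is the disjunction over
  \<open>(i, j) \<in> I\<close> of \<open>x\<^sub>i \<noteq> x\<^sub>j\<close>.\<close>

type_synonym clause = "(nat \<times> nat) set"

definition clause_on :: "nat \<Rightarrow> clause \<Rightarrow> bool" where
  "clause_on n I \<longleftrightarrow> I \<subseteq> {1..n} \<times> {1..n} \<and> (\<forall>(i, j)\<in>I. i \<noteq> j)"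

definition clause_true :: "(nat \<Rightarrow> nat) \<Rightarrow> clause \<Rightarrow> bool" where
  "clause_true x I \<longleftrightarrow> (\<exists>(i, j)\<in>I. x i \<noteq> x j)"

definition clause_verts :: "clause \<Rightarrow> nat set" where
  "clause_verts I = {i. \<exists>j. (i, j) \<in> I \<or> (j, i) \<in> I}"

definition clause_edges :: "clause \<Rightarrow> nat set set" where
  "clause_edges I = {{i, j} | i j. (i, j) \<in> I}"

definition clause_components :: "clause \<Rightarrow> nat set set" where
  "clause_components I =
     clause_verts I // Restr ({(u, v). {u, v} \<in> clause_edges I}\<^sup>*) (clause_verts I)"

definition clause_partition :: "clause \<Rightarrow> nat list" where
  "clause_partition I =
     rev (sorted_list_of_multiset (image_mset card (mset_set (clause_components I))))"

text \<open>A graph-like scheduling problem on \<open>n\<close> elements is an indexed family of clauses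
  \<open>(C \<alpha>)\<close> for \<open>\<alpha> \<in> J\<close>, and its size is \<open>card J\<close>.  Clauses with the same components are
  meant to be identified. No quotient is formed, because truth and the associated partition
  depend only on the components (see \<open>clause_true_iff_components\<close> below). Two members of
  a family may be equal or have the same components, so families of pairwise non-identified
  clauses are a special case.\<close>

definition scheduling_problem :: "nat \<Rightarrow> 'i set \<Rightarrow> ('i \<Rightarrow> clause) \<Rightarrow> bool" where
  "scheduling_problem n J C \<longleftrightarrow> finite J \<and> (\<forall>\<alpha>\<in>J. clause_on n (C \<alpha>))"

text \<open>Only the values of an assignment on \<open>{1..n}\<close> are relevant.\<close>

definition solution :: "'i set \<Rightarrow> ('i \<Rightarrow> clause) \<Rightarrow> (nat \<Rightarrow> nat) \<Rightarrow> bool" where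
  "solution J C x \<longleftrightarrow> (\<forall>\<alpha>\<in>J. clause_true x (C \<alpha>))"

definition property_B :: "nat \<Rightarrow> 'i set \<Rightarrow> ('i \<Rightarrow> clause) \<Rightarrow> bool" where
  "property_B n J C \<longleftrightarrow> (\<exists>x. solution J C x \<and> (\<forall>i\<in>{1..n}. x i \<in> {0, 1}))"

definition uniform :: "nat list \<Rightarrow> 'i set \<Rightarrow> ('i \<Rightarrow> clause) \<Rightarrow> bool" where
  "uniform lam J C \<longleftrightarrow> (\<forall>\<alpha>\<in>J. clause_partition (C \<alpha>) = lam)"

text \<open>Every finite index set is in bijection with a finite set of natural numbers, so
  indexing by \<open>nat\<close> loses no sizes.\<close>

definition ms :: "nat list \<Rightarrow> nat" where
  "ms lam = (LEAST m. \<exists>n (J :: nat set) C.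
     scheduling_problem n J C \<and> uniform lam J C \<and> \<not> property_B n J C \<and> card J = m)"

lemma clause_true_iff_components:
  "clause_true x I \<longleftrightarrow> (\<exists>K\<in>clause_components I. \<exists>u\<in>K. \<exists>v\<in>K. x u \<noteq> x v)"
proof -
  define A where "A = {(u, v). {u, v} \<in> clause_edges I}"
  define R where "R = Restr (A\<^sup>*) (clause_verts I)"
  have comps: "clause_components I = clause_verts I // R"
    unfolding clause_components_def A_def R_def ..
  have A_iff: "(u, v) \<in> A \<longleftrightarrow> (u, v) \<in> I \<or> (v, u) \<in> I" for u v
    unfolding A_def clause_edges_def mem_Collect_eq case_prod_conv doubleton_eq_iff by blast
  show ?thesis
  proof
    assume "clause_true x I"
    then obtain i j where ij: "(i, j) \<in> I" "x i \<noteq> x j"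
      unfolding clause_true_def by blast
    then have V: "i \<in> clause_verts I" "j \<in> clause_verts I"
      unfolding clause_verts_def by blast+
    have "(i, j) \<in> A\<^sup>*"
      using A_iff ij(1) by (blast intro: r_into_rtrancl)
    then have mem: "i \<in> R `` {i}" "j \<in> R `` {i}"
      using V unfolding R_def by blast+
    have "R `` {i} \<in> clause_components I"
      unfolding comps using V(1) by (rule quotientI)
    then show "\<exists>K\<in>clause_components I. \<exists>u\<in>K. \<exists>v\<in>K. x u \<noteq> x v"
      using mem ij(2) by (intro bexI)
  next
    assume "\<exists>K\<in>clause_components I. \<exists>u\<in>K. \<exists>v\<in>K. x u \<noteq> x v"
    then obtain K u v where K: "K \<in> clause_verts I // R" and uv: "u \<in> K" "v \<in> K" "x u \<noteq> x v"
      unfolding comps by (elim bexE)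
    from K obtain w where "K = R `` {w}"
      by (rule quotientE)
    with uv have reach: "(w, u) \<in> A\<^sup>*" "(w, v) \<in> A\<^sup>*"
      unfolding R_def by blast+
    show "clause_true x I"
    proof (rule ccontr)
      assume false: "\<not> clause_true x I"
      have eq: "x i = x j" if "(i, j) \<in> I" for i j
        using that false unfolding clause_true_def by blast
      have edge: "x a = x b" if "(a, b) \<in> A" for a b
        using that eq[of a b] eq[of b a] unfolding A_iff by metis
      have "x a = x b" if "(a, b) \<in> A\<^sup>*" for a b
        using that
      proof (induction rule: rtrancl_induct)
        case base
        show ?case ..
      next
        case (step b c)
        from step.IH edge[OF step.hyps(2)] show ?case by (rule trans)
      qed
      from this[OF reach(1)] this[OF reach(2)] uv(3) show False by metis
    qed
  qed
qed

end

theory Submission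
  imports Defs
begin

text \<open>The lower bound is Erdos's union bound for property B of hypergraphs, with an
  exact count of the bad colourings of one clause. A clause fails under a 0/1 assignment exactly
  when the assignment is constant on every component of its graph
  (\<open>clause_true_iff_components\<close>). If the \<open>\<ell>\<close> components cover \<open>k\<close> of the \<open>n\<close> elements, such an
  assignment amounts to one free bit per component and one free bit per uncovered element,
  so at most \<open>2 ^ (\<ell> + (n - k))\<close> of the \<open>2 ^ n\<close> assignments violate the clause
  (\<open>card_constant_on_components\<close>). Fewer than \<open>2 ^ (k - \<ell>)\<close> clauses therefore cannot exclude
  all assignments (\<open>property_B_if_few_clauses\<close>).

  The bound on \<open>ms\<close> follows once the minimum is known to range over a nonempty set: otherwise
  \<open>LEAST\<close> would denote an arbitrary number. A problem without property B consists of all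
  \<open>\<lambda>\<close>-uniform clauses on \<open>2k\<close> elements (\<open>ex_uniform_not_property_B\<close>). By the pigeonhole principle
  every 0/1 assignment has \<open>k\<close> elements of one colour, and inside these there is room for
  disjoint blocks of the sizes prescribed by \<open>\<lambda>\<close>; the clause with these blocks as components
  fails. It is here that parts equal to \<open>1\<close> must be excluded, since no component of a
  clause graph is a single vertex.\<close>


section \<open>Components of a clause\<close>

lemma equiv_clause_connected:
  "equiv (clause_verts I) (Restr ({(u, v). {u, v} \<in> clause_edges I}\<^sup>*) (clause_verts I))"
proof -
  have "sym {(u, v). {u, v} \<in> clause_edges I}"
    by (auto intro: symI simp: insert_commute)
  then have "sym ({(u, v). {u, v} \<in> clause_edges I}\<^sup>*)"
    by (rule sym_rtrancl)
  then show ?thesis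
    by (intro equivI refl_onI symI transI) (auto dest: symD intro: rtrancl_trans)
qed

lemma Union_clause_components: "\<Union>(clause_components I) = clause_verts I"
  unfolding clause_components_def by (rule Union_quotient[OF equiv_clause_connected])

lemma disjoint_clause_components:
  "K \<in> clause_components I \<Longrightarrow> L \<in> clause_components I \<Longrightarrow> K \<noteq> L \<Longrightarrow> K \<inter> L = {}"
  unfolding clause_components_def using quotient_disj[OF equiv_clause_connected] by blast

lemma clause_verts_subset:
  assumes "clause_on n I"
  shows "clause_verts I \<subseteq> {1..n}"
  using assms unfolding clause_on_def clause_verts_def by blast

lemma finite_clause_components:
  assumes "clause_on n I"
  shows "finite (clause_components I)"
  using finite_subset[OF clause_verts_subset[OF assms]] Union_clause_components[of I]
  by (metis finite_UnionD finite_atLeastAtMost)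

lemma mset_clause_partition:
  "mset (clause_partition I) = image_mset card (mset_set (clause_components I))"
  unfolding clause_partition_def by simp

lemma card_clause_components: "card (clause_components I) = length (clause_partition I)"
proof -
  have "size (mset (clause_partition I)) = card (clause_components I)"
    unfolding mset_clause_partition by simp
  then show ?thesis by simp
qed

lemma card_clause_verts:
  assumes "clause_on n I"
  shows "card (clause_verts I) = sum_list (clause_partition I)"
proof -
  have "finite (clause_verts I)"
    using clause_verts_subset[OF assms] finite_subset by blast
  then have "finite K" if "K \<in> clause_components I" for K
    using that Union_clause_components[of I] by (metis Union_upper finite_subset)
  then have "card (\<Union>(clause_components I)) = sum card (clause_components I)"
    using disjoint_clause_components by (intro card_Union_disjoint) (auto simp: pairwise_def disjnt_def)
  also have "\<dots> = sum_mset (mset (clause_partition I))"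
    unfolding mset_clause_partition by (simp add: sum_unfold_sum_mset)
  finally show ?thesis
    unfolding Union_clause_components sum_mset_sum_list .
qed


section \<open>The union bound\<close>

text \<open>Assignments are functions on all natural numbers, so even the 0/1-valued ones are infinite in
  number. Subsets of \<open>{1..n}\<close> stand for them in the count.\<close>

definition violating_sets :: "nat \<Rightarrow> clause \<Rightarrow> nat set set" where
  "violating_sets n I = {A. A \<subseteq> {1..n} \<and> \<not> clause_true (\<lambda>i. of_bool (i \<in> A)) I}"

text \<open>A violating set contains or avoids each component, so it is recovered from the components
  it contains together with its part outside the vertices of the clause.\<close>

lemma card_constant_on_components:
  assumes "clause_on n I"
  shows "card (violating_sets n I)
    \<le> 2 ^ (length (clause_partition I) + (n - sum_list (clause_partition I)))"
proof -
  let ?P = "clause_components I" and ?U = "{1..n} - clause_verts I"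
  define code where "code A = ({K \<in> ?P. K \<subseteq> A}, A \<inter> ?U)" for A
  define decode :: "nat set set \<times> nat set \<Rightarrow> nat set" where "decode = (\<lambda>(Q, B). \<Union>Q \<union> B)"
  have "decode (code A) = A" if "A \<in> violating_sets n I" for A
  proof -
    have sub: "A \<subseteq> {1..n}" and "\<not> clause_true (\<lambda>i. of_bool (i \<in> A)) I"
      using that unfolding violating_sets_def by auto
    then have "(u \<in> A) = (v \<in> A)" if "K \<in> ?P" "u \<in> K" "v \<in> K" for K u v
      using that unfolding clause_true_iff_components by (metis of_bool_eq_iff)
    then have "A \<inter> \<Union>?P \<subseteq> \<Union>{K \<in> ?P. K \<subseteq> A}" by blast
    then show ?thesis
      using sub unfolding Union_clause_components code_def decode_def by auto
  qed
  then have inj: "inj_on code (violating_sets n I)" by (rule inj_on_inverseI)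
  have fin: "finite (Pow ?P \<times> Pow ?U)"
    using finite_clause_components[OF assms] by simp
  have "card (violating_sets n I) \<le> card (Pow ?P \<times> Pow ?U)"
    by (rule card_inj_on_le[OF inj _ fin]) (auto simp: code_def)
  also have "\<dots> = 2 ^ (card ?P + card ?U)"
    using finite_clause_components[OF assms] by (simp add: card_cartesian_product card_Pow power_add)
  also have "card ?U = n - card (clause_verts I)"
    using clause_verts_subset[OF assms] by (simp add: card_Diff_subset finite_subset)
  finally show ?thesis
    by (simp add: card_clause_components card_clause_verts[OF assms])
qed

lemma property_B_if_few_clauses:
  assumes "scheduling_problem n J C" and "uniform lam J C"
    and few: "card J < 2 ^ (sum_list lam - length lam)"
  shows "property_B n J C"
proof (cases "J = {}")
  case True
  then show ?thesis
    unfolding property_B_def solution_def by (intro exI[of _ "\<lambda>_. 0"]) simp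
next
  case False
  have fin: "finite J" and on: "\<And>\<alpha>. \<alpha> \<in> J \<Longrightarrow> clause_on n (C \<alpha>)"
    and part: "\<And>\<alpha>. \<alpha> \<in> J \<Longrightarrow> clause_partition (C \<alpha>) = lam"
    using assms(1,2) unfolding scheduling_problem_def uniform_def by auto
  \<comment> \<open>The subtraction in the exponent is truncated, and exponent \<open>0\<close> would force \<open>J\<close> to be empty.\<close>
  have "0 < card J" using False fin by (simp add: card_gt_0_iff)
  then have len: "length lam \<le> sum_list lam"
    using few by (cases "length lam \<le> sum_list lam") simp_all
  \<comment> \<open>Any one clause already shows that its \<open>sum_list lam\<close> vertices fit into \<open>{1..n}\<close>.\<close>
  from False obtain \<beta> where "\<beta> \<in> J" by blast
  then have le: "sum_list lam \<le> n"
    using card_clause_verts[OF on] part card_mono[OF _ clause_verts_subset[OF on]] by fastforce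
  have "card (\<Union>\<alpha>\<in>J. violating_sets n (C \<alpha>)) \<le> (\<Sum>\<alpha>\<in>J. card (violating_sets n (C \<alpha>)))"
    by (rule card_UN_le[OF fin])
  also have "\<dots> \<le> (\<Sum>\<alpha>\<in>J. 2 ^ (length lam + (n - sum_list lam)))"
    using card_constant_on_components[OF on] part by (intro sum_mono) fastforce
  also have "\<dots> = card J * 2 ^ (length lam + (n - sum_list lam))" by simp
  also have "\<dots> < 2 ^ (sum_list lam - length lam) * 2 ^ (length lam + (n - sum_list lam))"
    using few by simp
  also have "\<dots> = 2 ^ n"
    unfolding power_add[symmetric] using le len by simp
  also have "\<dots> = card (Pow {1..n})" by (simp add: card_Pow)
  finally have less: "card (\<Union>\<alpha>\<in>J. violating_sets n (C \<alpha>)) < card (Pow {1..n})" .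
  have "(\<Union>\<alpha>\<in>J. violating_sets n (C \<alpha>)) \<subseteq> Pow {1..n}"
    unfolding violating_sets_def by blast
  then have "finite (\<Union>\<alpha>\<in>J. violating_sets n (C \<alpha>))"
    by (rule finite_subset) simp
  then have "\<not> Pow {1..n} \<subseteq> (\<Union>\<alpha>\<in>J. violating_sets n (C \<alpha>))"
    using less card_mono leD by blast
  then obtain A where "A \<subseteq> {1..n}" "\<And>\<alpha>. \<alpha> \<in> J \<Longrightarrow> A \<notin> violating_sets n (C \<alpha>)" by blast
  then have "solution J C (\<lambda>i. of_bool (i \<in> A))"
    unfolding solution_def violating_sets_def by blast
  then show ?thesis
    unfolding property_B_def by (intro exI[of _ "\<lambda>i. of_bool (i \<in> A)"]) simp
qed


section \<open>Uniform problems without property B\<close>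

definition clause_of_blocks :: "nat set set \<Rightarrow> clause" where
  "clause_of_blocks P = {(u, v). u \<noteq> v \<and> (\<exists>K\<in>P. u \<in> K \<and> v \<in> K)}"

text \<open>Inside a block the clause graph is complete, and no edge leaves a block. A block of one element
  would leave no trace in the clause, hence the bound on the block sizes.\<close>

lemma clause_components_of_blocks:
  assumes disj: "\<And>K L. K \<in> P \<Longrightarrow> L \<in> P \<Longrightarrow> K \<noteq> L \<Longrightarrow> K \<inter> L = {}"
    and two: "\<And>K. K \<in> P \<Longrightarrow> 2 \<le> card K"
  shows "clause_components (clause_of_blocks P) = P"
proof -
  let ?I = "clause_of_blocks P"
  define A where "A = {(u, v). {u, v} \<in> clause_edges ?I}"
  have A_iff: "(u, v) \<in> A \<longleftrightarrow> u \<noteq> v \<and> (\<exists>K\<in>P. u \<in> K \<and> v \<in> K)" for u v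
    unfolding A_def clause_edges_def clause_of_blocks_def by (auto simp: doubleton_eq_iff)
  \<comment> \<open>Every vertex of a block has a partner in it, so all block vertices occur in the clause.\<close>
  have verts: "clause_verts ?I = \<Union>P"
  proof
    show "clause_verts ?I \<subseteq> \<Union>P"
      unfolding clause_verts_def clause_of_blocks_def by blast
    show "\<Union>P \<subseteq> clause_verts ?I"
    proof
      fix u assume "u \<in> \<Union>P"
      then obtain K where K: "K \<in> P" "u \<in> K" by blast
      have "\<not> K \<subseteq> {u}"
        using card_mono[of "{u}" K] two[OF K(1)] by auto
      with K show "u \<in> clause_verts ?I"
        unfolding clause_verts_def clause_of_blocks_def by blast
    qed
  qed
  have stays: "v \<in> K" if "(u, v) \<in> A\<^sup>*" "u \<in> K" "K \<in> P" for u v K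
    using that
  proof (induction rule: rtrancl_induct)
    case (step v w)
    then show ?case using disj A_iff by blast
  qed
  have reach: "(u, v) \<in> A\<^sup>*" if "u \<in> K" "v \<in> K" "K \<in> P" for u v K
    using that A_iff by (cases "u = v") (auto intro: r_into_rtrancl)
  have block: "Restr (A\<^sup>*) (\<Union>P) `` {u} = K" if "u \<in> K" "K \<in> P" for u K
  proof
    show "Restr (A\<^sup>*) (\<Union>P) `` {u} \<subseteq> K"
      using stays[OF _ that] by blast
    show "K \<subseteq> Restr (A\<^sup>*) (\<Union>P) `` {u}"
      using reach[OF that(1) _ that(2)] that by blast
  qed
  have "\<Union>P // Restr (A\<^sup>*) (\<Union>P) = P"
  proof (intro equalityI subsetI)
    fix L assume "L \<in> \<Union>P // Restr (A\<^sup>*) (\<Union>P)"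
    then obtain u K where "u \<in> K" "K \<in> P" "L = Restr (A\<^sup>*) (\<Union>P) `` {u}"
      by (blast elim: quotientE)
    then show "L \<in> P" using block by metis
  next
    fix K assume K: "K \<in> P"
    then obtain u where "u \<in> K" using two[OF K] by fastforce
    then show "K \<in> \<Union>P // Restr (A\<^sup>*) (\<Union>P)"
      using block[OF _ K] quotientI K by (metis UnionI)
  qed
  then show ?thesis
    unfolding clause_components_def verts A_def[symmetric] .
qed

text \<open>Blocks can be cut off \<open>M\<close> greedily. Each is nonempty, so it cannot coincide with a block chosen
  in the rest of \<open>M\<close>, and equal parts give different members of \<open>P\<close>.\<close>

lemma ex_disjoint_blocks:
  fixes M :: "'a set"
  assumes "finite M" and "sum_list lam \<le> card M" and "\<And>p. p \<in> set lam \<Longrightarrow> 0 < p"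
  shows "\<exists>P. finite P \<and> \<Union>P \<subseteq> M \<and> (\<forall>K\<in>P. \<forall>L\<in>P. K \<noteq> L \<longrightarrow> K \<inter> L = {})
    \<and> image_mset card (mset_set P) = mset lam"
  using assms
proof (induction lam arbitrary: M)
  case Nil
  show ?case by (intro exI[of _ "{}"]) simp
next
  case (Cons p lam)
  then have "p \<le> card M" by simp
  then obtain K where K: "K \<subseteq> M" "card K = p" "finite K"
    using obtain_subset_with_card_n by blast
  have "sum_list lam \<le> card (M - K)"
    using Cons.prems(2) K by (simp add: card_Diff_subset)
  then obtain P where P: "finite P" "\<Union>P \<subseteq> M - K" "\<forall>K\<in>P. \<forall>L\<in>P. K \<noteq> L \<longrightarrow> K \<inter> L = {}"
    "image_mset card (mset_set P) = mset lam"
    using Cons.IH[of "M - K"] Cons.prems by auto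
  have "K \<noteq> {}" using K(2) Cons.prems(3)[of p] by auto
  then have "K \<notin> P" using P(2) by blast
  then have "image_mset card (mset_set (insert K P)) = mset (p # lam)"
    using P K by simp
  moreover have "\<Union>(insert K P) \<subseteq> M" using P(2) K(1) by blast
  moreover have "\<forall>L\<in>insert K P. \<forall>L'\<in>insert K P. L \<noteq> L' \<longrightarrow> L \<inter> L' = {}"
    using P(2,3) by blast
  ultimately show ?case using P(1) by (intro exI[of _ "insert K P"]) simp
qed

lemma ex_clause_inside:
  assumes "M \<subseteq> {1..n}" and "sum_list lam \<le> card M"
    and "sorted_wrt (\<ge>) lam" and two: "\<And>p. p \<in> set lam \<Longrightarrow> 2 \<le> p"
  shows "\<exists>I. clause_on n I \<and> clause_partition I = lam \<and> clause_verts I \<subseteq> M"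
proof -
  have pos: "0 < p" if "p \<in> set lam" for p using two[OF that] by simp
  have "finite M" using assms(1) finite_subset by blast
  then obtain P where P: "finite P" "\<Union>P \<subseteq> M" "\<forall>K\<in>P. \<forall>L\<in>P. K \<noteq> L \<longrightarrow> K \<inter> L = {}"
    "image_mset card (mset_set P) = mset lam"
    using ex_disjoint_blocks[OF _ assms(2) pos] by blast
  have "2 \<le> card K" if "K \<in> P" for K
  proof -
    have "card K \<in># image_mset card (mset_set P)" using that P(1) by simp
    then show ?thesis using two unfolding P(4) by simp
  qed
  then have comps: "clause_components (clause_of_blocks P) = P"
    using P(3) by (intro clause_components_of_blocks) auto
  have verts: "clause_verts (clause_of_blocks P) \<subseteq> M"
    using P(2) Union_clause_components[of "clause_of_blocks P"] comps by simp
  have "sorted (rev lam)" using assms(3) by (simp add: sorted_wrt_rev)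
  then have "sorted_list_of_multiset (mset lam) = rev lam"
    by (metis mset_rev sorted_list_of_multiset_mset sorted_sort_id)
  then have "clause_partition (clause_of_blocks P) = lam"
    unfolding clause_partition_def comps P(4) by simp
  moreover have "clause_on n (clause_of_blocks P)"
    using P(2) assms(1) unfolding clause_on_def clause_of_blocks_def by blast
  ultimately show ?thesis using verts by blast
qed

text \<open>With \<open>2k\<close> elements, one of the two colour classes of any 0/1 assignment has at least \<open>k\<close>
  elements, and a clause with all its vertices in that class fails. Listing all \<open>\<lambda>\<close>-uniform clauses
  makes sure that this clause belongs to the problem.\<close>

lemma ex_uniform_not_property_B:
  assumes "sorted_wrt (\<ge>) lam" and "\<And>p. p \<in> set lam \<Longrightarrow> 2 \<le> p"
  shows "\<exists>n (J :: nat set) C. scheduling_problem n J C \<and> uniform lam J C \<and> \<not> property_B n J C"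
proof -
  define n where "n = 2 * sum_list lam"
  define \<C> where "\<C> = {I. clause_on n I \<and> clause_partition I = lam}"
  have "\<C> \<subseteq> Pow ({1..n} \<times> {1..n})"
    unfolding \<C>_def clause_on_def by blast
  then have "finite \<C>" by (rule finite_subset) simp
  then obtain C where C: "bij_betw C {0..<card \<C>} \<C>"
    using ex_bij_betw_nat_finite by blast
  let ?J = "{0..<card \<C>}"
  have img: "C ` ?J = \<C>" using C by (simp add: bij_betw_def)
  have "\<not> property_B n ?J C"
  proof
    assume "property_B n ?J C"
    then obtain x where sol: "solution ?J C x" and bits: "\<forall>i\<in>{1..n}. x i \<in> {0, 1}"
      unfolding property_B_def by blast
    let ?M = "\<lambda>b. {i \<in> {1..n}. x i = b}"
    have "?M 0 \<union> ?M 1 = {1..n}" using bits by auto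
    then have "n \<le> card (?M 0) + card (?M 1)"
      using card_Un_le[of "?M 0" "?M 1"] by simp
    then have "sum_list lam \<le> card (?M 0) \<or> sum_list lam \<le> card (?M 1)"
      unfolding n_def by linarith
    then obtain b where "sum_list lam \<le> card (?M b)" by blast
    then obtain I where I: "clause_on n I" "clause_partition I = lam" "clause_verts I \<subseteq> ?M b"
      using ex_clause_inside[OF _ _ assms, of "?M b" n] by blast
    then have "I \<in> C ` ?J" unfolding img by (simp add: \<C>_def)
    then have "clause_true x I" using sol unfolding solution_def by blast
    then obtain i j where "(i, j) \<in> I" "x i \<noteq> x j"
      unfolding clause_true_def by blast
    moreover from this have "i \<in> ?M b" "j \<in> ?M b"
      using I(3) unfolding clause_verts_def by blast+
    ultimately show False by simp
  qed
  moreover have "scheduling_problem n ?J C" "uniform lam ?J C"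
    using img unfolding scheduling_problem_def uniform_def \<C>_def by auto
  ultimately show ?thesis by blast
qed


section \<open>The lower bound\<close>

theorem theorem2p5:
  fixes k :: nat and lam :: "nat list"
  assumes "0 < k"
    and "integer_partition k lam"
    and "1 \<notin> set lam"
  shows "(\<forall>n (J :: 'i set) C.
            scheduling_problem n J C \<and> uniform lam J C \<and> card J < 2 ^ (k - length lam)
              \<longrightarrow> property_B n J C)
         \<and> 2 ^ (k - length lam) \<le> ms lam"
proof -
  have sorted: "sorted_wrt (\<ge>) lam" and sum: "sum_list lam = k"
    and pos: "\<And>p. p \<in> set lam \<Longrightarrow> 0 < p"
    using assms(2) unfolding integer_partition_def by auto
  have two: "2 \<le> p" if "p \<in> set lam" for p
    using pos[OF that] that assms(3) by (cases "p = 1") auto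
  have "\<exists>m n (J :: nat set) C.
      scheduling_problem n J C \<and> uniform lam J C \<and> \<not> property_B n J C \<and> card J = m"
    using ex_uniform_not_property_B[OF sorted two] by blast
  \<comment> \<open>The set being nonempty, \<open>ms\<close> is the size of an actual problem without property B.\<close>
  then have "\<exists>n (J :: nat set) C.
      scheduling_problem n J C \<and> uniform lam J C \<and> \<not> property_B n J C \<and> card J = ms lam"
    unfolding ms_def by (rule LeastI_ex)
  then obtain n and J :: "nat set" and C where J: "scheduling_problem n J C" "uniform lam J C"
    "\<not> property_B n J C" "card J = ms lam" by blast
  have "\<not> card J < 2 ^ (k - length lam)"
    using property_B_if_few_clauses[OF J(1,2)] J(3) unfolding sum by blast
  then have "2 ^ (k - length lam) \<le> ms lam"
    unfolding J(4) by simp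
  then show ?thesis
    using property_B_if_few_clauses[of _ _ _ lam] unfolding sum by blast
qed

end
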